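(* The Johnson graph $J(n,k)$ yields a binary even LCD code if and only if $n$ is odd.
   Context: The Johnson graph $J(n,k)$ has as vertices the $k$-element subsets of an $n$-element set, two being adjacent when they share exactly $k-1$ elements; its diameter is $\min(k,n-k)$. A binary code of length $N$ is a linear subspace $C\subseteq\mathbb{F}_2^N$. Its dual $C^\perp$ is taken with respect to $\langle x,y\rangle=\sum_i x_iy_i$. $C$ is LCD (linear complementary dual) if $C\cap C^\perp=\{0\}$, equivalently $\mathbb{F}_2^N=C\oplus C^\perp$. $C$ is even if every codeword has even Hamming weight. For an LCD code $C$, the orthogonal projector $\Pi_C$ is the unique $N\times N$ matrix over $\mathbb{F}_2$ with $v\Pi_C=v$ for all row vectors $v\in C$ and $v\Pi_C=0$ for all $v\in C^\perp$. A finite simple graph on $N$ (ordered) vertices with adjacency matrix $A$ is said to yield a binary even LCD code if $A$, read over $\mathbb{F}_2$, equals $\Pi_C$ for some binary even LCD code $C$ of length $N$ (equivalently, $A^2=A$ over $\mathbb{F}_2$); this $C$, which is the row span of $A$ over $\mathbb{F}_2$, is the code yielded by the graph. *)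

theory Defs
  imports
    "HOL-Library.Z2"
    "Jordan_Normal_Form.VS_Connect"
    "Graph_Theory.Pair_Digraph"
begin

(* A finite simple graph is a pair_graph, with both (u, v) and (v, u) as arcs for each edge.
   Writing "card (S \<inter> T) + 1 = k" instead of "card (S \<inter> T) = k - 1" avoids truncated
   subtraction, which would create a loop for k = 0. *)

definition johnson_graph :: "'a set \<Rightarrow> nat \<Rightarrow> 'a set pair_pre_digraph" where
  "johnson_graph X k =
     \<lparr> pverts = {S. S \<subseteq> X \<and> card S = k},
       parcs = {(S, T). S \<subseteq> X \<and> card S = k \<and> T \<subseteq> X \<and> card T = k \<and> card (S \<inter> T) + 1 = k} \<rparr>"

lemma pair_graph_johnson_graph:
  assumes "finite X"
  shows "pair_graph (johnson_graph X k)"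
proof -
  let ?V = "{S. S \<subseteq> X \<and> card S = k}"
  have "finite ?V"
    by (rule finite_subset[of _ "Pow X"]) (use assms in auto)
  have sub: "parcs (johnson_graph X k) \<subseteq> ?V \<times> ?V"
    unfolding johnson_graph_def by auto
  show ?thesis
  proof unfold_locales
    show "finite (pverts (johnson_graph X k))"
      using \<open>finite ?V\<close> by (simp add: johnson_graph_def)
    show "finite (parcs (johnson_graph X k))"
      using finite_subset[OF sub finite_cartesian_product[OF \<open>finite ?V\<close> \<open>finite ?V\<close>]] .
    show "symmetric (johnson_graph X k)"
    proof -
      have "sym (parcs (johnson_graph X k))"
        unfolding johnson_graph_def pair_pre_digraph.simps
        by (rule symI) (clarify, simp only: Int_commute)
      then show ?thesis
        by (simp only: symmetric_def with_proj_simps)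
    qed
  next
    fix e assume e: "e \<in> parcs (johnson_graph X k)"
    with sub have "e \<in> ?V \<times> ?V" by (rule subsetD)
    then show "fst e \<in> pverts (johnson_graph X k)" "snd e \<in> pverts (johnson_graph X k)"
      by (simp_all add: johnson_graph_def mem_Times_iff)
    show "fst e \<noteq> snd e"
      using e unfolding johnson_graph_def by (cases e) clarsimp
  qed
qed

definition binary_code :: "nat \<Rightarrow> bit vec set \<Rightarrow> bool" where
  "binary_code N C \<longleftrightarrow> VectorSpace.subspace class_ring C (module_vec TYPE(bit) N)"

definition dual_code :: "nat \<Rightarrow> bit vec set \<Rightarrow> bit vec set" where
  "dual_code N C = {x \<in> carrier_vec N. \<forall>c\<in>C. x \<bullet> c = 0}"

definition LCD_code :: "nat \<Rightarrow> bit vec set \<Rightarrow> bool" where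
  "LCD_code N C \<longleftrightarrow> binary_code N C \<and> C \<inter> dual_code N C = {0\<^sub>v N}"

definition hamming_weight :: "bit vec \<Rightarrow> nat" where
  "hamming_weight v = card {i. i < dim_vec v \<and> v $ i \<noteq> 0}"

definition even_code :: "bit vec set \<Rightarrow> bool" where
  "even_code C \<longleftrightarrow> (\<forall>c\<in>C. even (hamming_weight c))"

(* Existence and uniqueness of the projector hold for every LCD code C of length N; for other C
   the value is unspecified. *)

definition orthogonal_projector :: "nat \<Rightarrow> bit vec set \<Rightarrow> bit mat" where
  "orthogonal_projector N C =
     (THE P. P \<in> carrier_mat N N \<and>
             (\<forall>v\<in>C. mat_of_row v * P = mat_of_row v) \<and>
             (\<forall>v\<in>dual_code N C. mat_of_row v * P = 0\<^sub>m 1 N))"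

(* The list vs fixes the order of the vertices. *)

definition adjacency_matrix :: "'v pair_pre_digraph \<Rightarrow> 'v list \<Rightarrow> bit mat" where
  "adjacency_matrix G vs =
     mat (length vs) (length vs) (\<lambda>(i, j). if (vs ! i, vs ! j) \<in> parcs G then 1 else 0)"

definition yields_even_LCD_code :: "'v pair_pre_digraph \<Rightarrow> 'v list \<Rightarrow> bool" where
  "yields_even_LCD_code G vs \<longleftrightarrow>
     (\<exists>C. LCD_code (length vs) C \<and> even_code C \<and>
          adjacency_matrix G vs = orthogonal_projector (length vs) C)"

end

theory Submission
  imports Defs
begin

text \<open>Let \<open>A\<close> be a symmetric binary matrix with zero diagonal. If \<open>A\<close> is idempotent, it is the
  orthogonal projector of its fixed space, which is even because \<open>v \<bullet> v = v \<bullet> v A\<close> is a sum over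
  pairs of indices in which \<open>(i, j)\<close> and \<open>(j, i)\<close> cancel. Conversely every orthogonal projector
  is idempotent. So the question is when \<open>A\<^sup>2 = A\<close>, and the entries of \<open>A\<^sup>2\<close> count common neighbours
  modulo 2. In \<open>J(n,k)\<close> a vertex has \<open>k (n - k)\<close> neighbours, which is even for odd \<open>n\<close>;
  two adjacent vertices have \<open>n - 2\<close> common neighbours; two vertices at distance 2 have 4, and at a
  larger distance none.\<close>

section \<open>Orthogonal decomposition of binary LCD codes\<close>

lemma of_nat_bit: "(of_nat m :: bit) = (if even m then 0 else 1)"
  by (induction m) auto

lemma finite_carrier_vec_bit: "finite (carrier_vec N :: bit vec set)"
proof -
  have "carrier_vec N \<subseteq> vec_of_list ` {xs :: bit list. set xs \<subseteq> {0, 1} \<and> length xs = N}"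
  proof
    fix v :: "bit vec" assume "v \<in> carrier_vec N"
    then show "v \<in> vec_of_list ` {xs. set xs \<subseteq> {0, 1} \<and> length xs = N}"
      by (intro image_eqI[of _ _ "list_of_vec v"]) (auto simp: vec_list)
  qed
  moreover have "finite {xs :: bit list. set xs \<subseteq> {0, 1} \<and> length xs = N}"
    by (rule finite_lists_length_eq) simp
  ultimately show ?thesis by (meson finite_imageI finite_subset)
qed

text \<open>The only scalars are 0 and 1, so closure under scalar multiplication already follows
  from containing the zero vector.\<close>

lemma binary_code_iff:
  "binary_code N C \<longleftrightarrow>
     C \<subseteq> carrier_vec N \<and> 0\<^sub>v N \<in> C \<and> (\<forall>u\<in>C. \<forall>v\<in>C. u + v \<in> C)"
proof
  assume "binary_code N C"
  then have "submodule class_ring C (module_vec TYPE(bit) N)"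
    by (simp add: binary_code_def VectorSpace.subspace_def)
  then show "C \<subseteq> carrier_vec N \<and> 0\<^sub>v N \<in> C \<and> (\<forall>u\<in>C. \<forall>v\<in>C. u + v \<in> C)"
    by (auto simp: submodule_def module_vec_simps)
next
  assume C: "C \<subseteq> carrier_vec N \<and> 0\<^sub>v N \<in> C \<and> (\<forall>u\<in>C. \<forall>v\<in>C. u + v \<in> C)"
  interpret vec_space "TYPE(bit)" N .
  have "c \<cdot>\<^sub>v v \<in> C" if "v \<in> C" for c v
    using C that by (cases c) auto
  then show "binary_code N C"
    unfolding binary_code_def VectorSpace.subspace_def submodule_def
    using C vectorspace_axioms module_axioms by (auto simp: module_vec_simps)
qed

text \<open>This is the nontrivial additive character of the two-element field. Its values are
  integers, so that character sums can be compared with cardinalities.\<close>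

definition bit_sign :: "bit \<Rightarrow> int" where
  "bit_sign b = (if b = 0 then 1 else - 1)"

lemma bit_sign_0 [simp]: "bit_sign 0 = 1"
  by (simp add: bit_sign_def)

text \<open>Translation by \<open>u\<close> permutes \<open>C\<close> and flips every sign, because
  \<open>v \<bullet> u = 1\<close>. The sum therefore equals its own negative.\<close>

lemma sum_bit_sign_eq_0:
  assumes C: "binary_code N C" and v: "v \<in> carrier_vec N" and u: "u \<in> C" "v \<bullet> u \<noteq> 0"
  shows "(\<Sum>c\<in>C. bit_sign (v \<bullet> c)) = 0"
proof -
  have carr: "C \<subseteq> carrier_vec N" and add: "\<And>c. c \<in> C \<Longrightarrow> c + u \<in> C"
    using C u by (auto simp: binary_code_iff)
  have uc: "u \<in> carrier_vec N" using carr u by auto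
  \<comment> \<open>In characteristic 2 translation by \<open>u\<close> is an involution, so it
    serves as its own inverse in the reindexing below.\<close>
  have inv: "c + u + u = c" if "c \<in> C" for c
    by (rule eq_vecI) (use that carr uc in \<open>auto simp: add.assoc\<close>)
  have "(\<Sum>c\<in>C. bit_sign (v \<bullet> c)) = (\<Sum>c\<in>C. bit_sign (v \<bullet> (c + u)))"
    by (rule sum.reindex_bij_witness[of _ "\<lambda>c. c + u" "\<lambda>c. c + u"]) (auto simp: inv add)
  also have "\<dots> = (\<Sum>c\<in>C. - bit_sign (v \<bullet> c))"
  proof (rule sum.cong)
    fix c assume "c \<in> C"
    then have "v \<bullet> (c + u) = v \<bullet> c + v \<bullet> u"
      using carr uc v by (intro scalar_prod_add_distrib) auto
    with u show "bit_sign (v \<bullet> (c + u)) = - bit_sign (v \<bullet> c)"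
      by (cases "v \<bullet> c") (auto simp: bit_sign_def)
  qed simp
  finally show ?thesis by (simp add: sum_negf)
qed

lemma binary_code_carrier: "binary_code N (carrier_vec N)"
  by (simp add: binary_code_iff)

text \<open>Double counting of the character sum of \<open>(-1)\<^sup>v\<^sup>\<bullet>\<^sup>c\<close> over all words \<open>v\<close> and codewords \<open>c\<close>.\<close>
lemma card_code_times_card_dual:
  assumes C: "binary_code N C"
  shows "card C * card (dual_code N C) = card (carrier_vec N :: bit vec set)"
proof -
  let ?V = "carrier_vec N :: bit vec set"
  have carr: "C \<subseteq> ?V" and zero: "0\<^sub>v N \<in> C"
    using C by (auto simp: binary_code_iff)
  have fin: "finite ?V" "finite C"
    using finite_carrier_vec_bit carr finite_subset by auto
  \<comment> \<open>If \<open>v\<close> lies in the dual, all signs are 1; otherwise some codeword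
    has scalar product 1 with \<open>v\<close> and the signs cancel.\<close>
  have row: "(\<Sum>c\<in>C. bit_sign (v \<bullet> c)) = (if v \<in> dual_code N C then int (card C) else 0)"
    if v: "v \<in> ?V" for v
    using sum_bit_sign_eq_0[OF C v] v by (auto simp: dual_code_def)
  have col: "(\<Sum>v\<in>?V. bit_sign (v \<bullet> c)) = (if c = 0\<^sub>v N then int (card ?V) else 0)"
    if c: "c \<in> C" for c
  proof (cases "c = 0\<^sub>v N")
    case False
    have cc: "c \<in> ?V" using c carr by auto
    have "\<exists>i<N. c $ i \<noteq> 0"
    proof (rule ccontr)
      assume "\<not> ?thesis"
      then have "c = 0\<^sub>v N" using cc by (intro eq_vecI) auto
      with False show False by simp
    qed
    then obtain i where i: "i < N" "c $ i \<noteq> 0" by auto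
    \<comment> \<open>The cancellation lemma is applied with the whole space as the code and
      \<open>c\<close> as the fixed word. The unit vector at a nonzero coordinate of
      \<open>c\<close> is the required non-orthogonal word.\<close>
    have "(\<Sum>v\<in>?V. bit_sign (c \<bullet> v)) = 0"
      by (rule sum_bit_sign_eq_0[OF binary_code_carrier cc, of "unit_vec N i"]) (use i cc in auto)
    moreover have "bit_sign (v \<bullet> c) = bit_sign (c \<bullet> v)" if "v \<in> ?V" for v
      using comm_scalar_prod[OF that cc] by simp
    ultimately show ?thesis using False by simp
  qed simp
  have "int (card C * card (dual_code N C)) = (\<Sum>v\<in>?V. if v \<in> dual_code N C then int (card C) else 0)"
    using fin by (simp add: sum.If_cases Int_def dual_code_def)
  also have "\<dots> = (\<Sum>v\<in>?V. \<Sum>c\<in>C. bit_sign (v \<bullet> c))"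
    using row by simp
  also have "\<dots> = (\<Sum>c\<in>C. \<Sum>v\<in>?V. bit_sign (v \<bullet> c))"
    by (rule sum.swap)
  also have "\<dots> = int (card ?V)"
    using col fin zero by simp
  finally show ?thesis by (simp only: of_nat_eq_iff)
qed

lemma binary_code_dual: "binary_code N C \<Longrightarrow> binary_code N (dual_code N C)"
  unfolding binary_code_iff dual_code_def
  by (auto simp: subset_iff add_scalar_prod_distrib[where n = N])

text \<open>Addition maps \<open>C \<times> dual_code N C\<close> injectively into the whole space,
  because the two codes meet only in 0. By \<open>card_code_times_card_dual\<close> both sides have
  the same finite size, so the map is onto.\<close>

lemma LCD_code_decomp:
  assumes "LCD_code N C" and v: "v \<in> carrier_vec N"
  obtains c d where "c \<in> C" "d \<in> dual_code N C" "v = c + d"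
proof -
  let ?V = "carrier_vec N :: bit vec set" and ?D = "dual_code N C"
  let ?f = "\<lambda>(c, d). c + d :: bit vec"
  have C: "binary_code N C" and triv: "C \<inter> ?D = {0\<^sub>v N}"
    using assms by (auto simp: LCD_code_def)
  have D: "binary_code N ?D" using C by (rule binary_code_dual)
  have carr: "C \<subseteq> ?V" "?D \<subseteq> ?V" using C D by (auto simp: binary_code_iff)
  have fin: "finite ?V" by (rule finite_carrier_vec_bit)
  have "inj_on ?f (C \<times> ?D)"
  proof (rule inj_onI, clarsimp)
    fix c d c' d'
    assume cd: "c \<in> C" "d \<in> ?D" "c' \<in> C" "d' \<in> ?D" and eq: "c + d = c' + d'"
    have dims: "c \<in> ?V" "d \<in> ?V" "c' \<in> ?V" "d' \<in> ?V" using cd carr by auto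
    \<comment> \<open>Signs do not matter in characteristic 2, so the equation separates into a
      codeword on one side and a dual word on the other. Their common value lies in the trivial
      intersection.\<close>
    have pt: "c $ i + c' $ i = d $ i + d' $ i" if "i < N" for i
    proof -
      have "(c + d) $ i = (c' + d') $ i" by (simp only: eq)
      then have "c $ i + d $ i = c' $ i + d' $ i" using that dims by simp
      then show ?thesis by (cases "c $ i"; cases "d $ i"; cases "c' $ i"; cases "d' $ i") auto
    qed
    have "c + c' = d + d'"
      by (rule eq_vecI) (use dims pt in auto)
    moreover have "c + c' \<in> C" "d + d' \<in> ?D"
      using C D cd by (auto simp: binary_code_iff)
    ultimately have *: "c + c' = 0\<^sub>v N" "d + d' = 0\<^sub>v N" using triv by auto
    have "x = y" if "x + y = 0\<^sub>v N" "x \<in> ?V" "y \<in> ?V" for x y :: "bit vec"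
    proof (rule eq_vecI)
      fix i assume i: "i < dim_vec y"
      then have "x $ i + y $ i = (x + y) $ i" by simp
      also have "\<dots> = 0" unfolding that(1) using i that(3) by simp
      finally have "x $ i + y $ i = 0" .
      then show "x $ i = y $ i" using i that by (cases "x $ i"; cases "y $ i") auto
    qed (use that in auto)
    with * dims show "c = c' \<and> d = d'" by auto
  qed
  then have "card (?f ` (C \<times> ?D)) = card ?V"
    using card_code_times_card_dual[OF C] by (simp add: card_image card_cartesian_product)
  moreover have "?f ` (C \<times> ?D) \<subseteq> ?V" using carr by (auto intro!: add_carrier_vec)
  ultimately have "?f ` (C \<times> ?D) = ?V" using fin by (simp add: card_subset_eq)
  with v have "v \<in> ?f ` (C \<times> ?D)" by blast
  with that show thesis by auto
qed

section \<open>Orthogonal projectors\<close>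

text \<open>The property under \<open>THE\<close> in \<open>orthogonal_projector\<close> gets a
  name, so that existence and uniqueness can be proved about it.\<close>

definition is_projector :: "nat \<Rightarrow> bit vec set \<Rightarrow> bit mat \<Rightarrow> bool" where
  "is_projector N C P \<longleftrightarrow> P \<in> carrier_mat N N \<and>
     (\<forall>v\<in>C. mat_of_row v * P = mat_of_row v) \<and>
     (\<forall>v\<in>dual_code N C. mat_of_row v * P = 0\<^sub>m 1 N)"

lemma mat_of_row_mult_eq_iff:
  assumes "P \<in> carrier_mat N N" "v \<in> carrier_vec N" "w \<in> carrier_vec N"
  shows "mat_of_row v * P = mat_of_row w \<longleftrightarrow> (\<forall>j<N. v \<bullet> col P j = w $ j)"
proof
  assume eq: "mat_of_row v * P = mat_of_row w"
  show "\<forall>j<N. v \<bullet> col P j = w $ j"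
  proof (intro allI impI)
    fix j assume "j < N"
    then show "v \<bullet> col P j = w $ j"
      using arg_cong[OF eq, of "\<lambda>M. M $$ (0, j)"] assms by simp
  qed
qed (use assms in \<open>auto intro!: eq_matI\<close>)

lemma is_projector_iff:
  assumes "binary_code N C"
  shows "is_projector N C P \<longleftrightarrow> P \<in> carrier_mat N N \<and>
     (\<forall>v\<in>C. \<forall>j<N. v \<bullet> col P j = v $ j) \<and> (\<forall>v\<in>dual_code N C. \<forall>j<N. v \<bullet> col P j = 0)"
proof -
  have carr: "C \<subseteq> carrier_vec N" "dual_code N C \<subseteq> carrier_vec N"
    using assms binary_code_dual by (auto simp: binary_code_iff)
  have "0\<^sub>m 1 N = mat_of_row (0\<^sub>v N :: bit vec)" by (rule eq_matI) auto
  then show ?thesis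
    unfolding is_projector_def using carr mat_of_row_mult_eq_iff[of P N]
    by (auto simp: subset_iff)
qed

text \<open>Row \<open>i\<close> of a projector is the image of the \<open>i\<close>-th unit vector.
  Writing that vector as \<open>c + d\<close> with \<open>c\<close> in the code and \<open>d\<close>
  in the dual forces the row to be \<open>c\<close>.\<close>

lemma is_projector_unique:
  assumes "LCD_code N C" and P: "is_projector N C P" and Q: "is_projector N C Q"
  shows "P = Q"
proof -
  have C: "binary_code N C" using assms by (simp add: LCD_code_def)
  have carr: "C \<subseteq> carrier_vec N" "dual_code N C \<subseteq> carrier_vec N"
    using C binary_code_dual by (auto simp: binary_code_iff)
  have dims: "P \<in> carrier_mat N N" "Q \<in> carrier_mat N N"
    using P Q by (auto simp: is_projector_def)
  have entry: "R $$ (i, j) = c $ j"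
    if R: "is_projector N C R" and ij: "i < N" "j < N"
      and cd: "c \<in> C" "d \<in> dual_code N C" "unit_vec N i = c + d" for R i j c d
  proof -
    have RN: "R \<in> carrier_mat N N" using R by (auto simp: is_projector_def)
    have "R $$ (i, j) = unit_vec N i \<bullet> col R j" using RN ij by simp
    also have "\<dots> = c \<bullet> col R j + d \<bullet> col R j"
      unfolding cd(3) by (rule add_scalar_prod_distrib) (use carr cd RN in auto)
    also have "\<dots> = c $ j" using R cd ij is_projector_iff[OF C] by auto
    finally show ?thesis .
  qed
  show ?thesis
  proof (rule eq_matI)
    fix i j assume "i < dim_row Q" "j < dim_col Q"
    then have ij: "i < N" "j < N" using dims by auto
    obtain c d where "c \<in> C" "d \<in> dual_code N C" "unit_vec N i = c + d"
      using LCD_code_decomp[OF assms(1), of "unit_vec N i"] by auto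
    then show "P $$ (i, j) = Q $$ (i, j)"
      using entry[OF P ij] entry[OF Q ij] by simp
  qed (use dims in auto)
qed

text \<open>Column \<open>j\<close> is chosen as the code component \<open>c j\<close> of the
  \<open>j\<close>-th unit vector. A codeword \<open>v\<close> is orthogonal to the other component
  \<open>d j\<close>, so \<open>v \<bullet> c j\<close> is its coordinate \<open>v $ j\<close>; a
  dual word is orthogonal to \<open>c j\<close>.\<close>

lemma is_projector_exists:
  assumes "LCD_code N C"
  shows "\<exists>P. is_projector N C P"
proof -
  have C: "binary_code N C" using assms by (simp add: LCD_code_def)
  have carr: "C \<subseteq> carrier_vec N" "dual_code N C \<subseteq> carrier_vec N"
    using C binary_code_dual by (auto simp: binary_code_iff)
  have "\<forall>j. \<exists>c d. c \<in> C \<and> d \<in> dual_code N C \<and> unit_vec N j = c + d"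
    using LCD_code_decomp[OF assms] by (metis unit_vec_carrier)
  then obtain c d where cd: "\<And>j. c j \<in> C" "\<And>j. d j \<in> dual_code N C" "\<And>j. unit_vec N j = c j + d j"
    by metis
  have cN: "c j \<in> carrier_vec N" "d j \<in> carrier_vec N" for j using cd carr by auto
  define P where "P = mat N N (\<lambda>(i, j). c j $ i)"
  have col: "col P j = c j" if "j < N" for j
    by (rule eq_vecI) (use that cN[of j] in \<open>auto simp: P_def\<close>)
  have "v \<bullet> c j = v $ j" if v: "v \<in> C" and j: "j < N" for v j
  proof -
    have vN: "v \<in> carrier_vec N" using v carr by auto
    have "v \<bullet> d j = 0"
      using cd(2)[of j] v comm_scalar_prod[OF vN cN(2)] by (simp add: dual_code_def)
    then have "v \<bullet> c j = v \<bullet> unit_vec N j"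
      unfolding cd(3) using scalar_prod_add_distrib[OF vN cN] by simp
    with vN j show ?thesis by simp
  qed
  moreover have "v \<bullet> c j = 0" if "v \<in> dual_code N C" for v j
    using that cd(1) by (simp add: dual_code_def)
  ultimately have "is_projector N C P"
    unfolding is_projector_iff[OF C] using col by (auto simp: P_def)
  then show ?thesis by blast
qed

lemma orthogonal_projector_eq_iff:
  assumes "LCD_code N C"
  shows "P = orthogonal_projector N C \<longleftrightarrow> is_projector N C P"
proof -
  have eq: "orthogonal_projector N C = (THE P. is_projector N C P)"
    by (simp add: orthogonal_projector_def is_projector_def)
  have "is_projector N C (orthogonal_projector N C)"
    unfolding eq using is_projector_exists[OF assms] is_projector_unique[OF assms]
    by (metis theI')
  then show ?thesis using is_projector_unique[OF assms] by blast
qed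

text \<open>The square also fixes the code and annihilates its dual, so uniqueness identifies it
  with \<open>P\<close>.\<close>

lemma is_projector_idem:
  assumes LCD: "LCD_code N C" and P: "is_projector N C P"
  shows "P * P = P"
proof (rule is_projector_unique[OF LCD _ P])
  have C: "binary_code N C" using LCD by (simp add: LCD_code_def)
  have carr: "C \<subseteq> carrier_vec N" "dual_code N C \<subseteq> carrier_vec N"
    using C binary_code_dual by (auto simp: binary_code_iff)
  have dims: "P \<in> carrier_mat N N" using P by (simp add: is_projector_def)
  have "mat_of_row v * (P * P) = mat_of_row v * P * P" if "v \<in> carrier_vec N" for v
    using assoc_mult_mat[of "mat_of_row v" 1 N P N P N] that dims by simp
  then show "is_projector N C (P * P)"
    using P carr dims unfolding is_projector_def by (auto simp: subset_iff)
qed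

section \<open>Symmetric idempotent matrices with zero diagonal as projectors of even codes\<close>

lemma sum_symmetric_bit_eq_0:
  fixes f :: "nat \<Rightarrow> nat \<Rightarrow> bit"
  assumes "\<And>i j. i < N \<Longrightarrow> j < N \<Longrightarrow> f i j = f j i" and "\<And>i. i < N \<Longrightarrow> f i i = 0"
  shows "(\<Sum>i<N. \<Sum>j<N. f i j) = 0"
  using assms
proof (induction N)
  case (Suc N)
  have "(\<Sum>i<N. f i N) = (\<Sum>j<N. f N j)"
    by (rule sum.cong) (use Suc.prems in auto)
  moreover have "(\<Sum>i<N. \<Sum>j<N. f i j) = 0"
    by (rule Suc.IH) (use Suc.prems in auto)
  moreover have "f N N = 0" using Suc.prems by simp
  \<comment> \<open>The last row and the last column are split off. By symmetry their sums agree and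
    cancel in characteristic 2, and the corner term is 0.\<close>
  moreover have "(\<Sum>i<Suc N. \<Sum>j<Suc N. f i j) =
      (\<Sum>i<N. \<Sum>j<N. f i j) + (\<Sum>i<N. f i N) + ((\<Sum>j<N. f N j) + f N N)"
    by (simp only: sum.lessThan_Suc sum.distrib ac_simps)
  ultimately show ?case by simp
qed simp

text \<open>Every bit equals its own square, so \<open>v \<bullet> v\<close> adds a 1 for each
  nonzero coordinate. Evenness of a word thus becomes self-orthogonality.\<close>

lemma of_nat_hamming_weight: "of_nat (hamming_weight v) = v \<bullet> v"
proof -
  have "v \<bullet> v = (\<Sum>i<dim_vec v. if v $ i \<noteq> 0 then 1 else 0)"
    unfolding scalar_prod_def atLeast0LessThan by (rule sum.cong) auto
  also have "\<dots> = of_nat (card {i\<in>{..<dim_vec v}. v $ i \<noteq> 0})"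
    by (simp add: sum.If_cases Int_def)
  finally show ?thesis by (simp add: hamming_weight_def)
qed

lemma symmetric_idem_is_projector:
  assumes A: "A \<in> carrier_mat N N"
    and sym: "\<And>i j. i < N \<Longrightarrow> j < N \<Longrightarrow> A $$ (i, j) = A $$ (j, i)"
    and diag: "\<And>i. i < N \<Longrightarrow> A $$ (i, i) = 0"
    and idem: "A * A = A"
  obtains C where "LCD_code N C" "even_code C" "is_projector N C A"
proof
  \<comment> \<open>This is the space of row vectors fixed by \<open>A\<close>, written through
    columns to match \<open>is_projector_iff\<close>.\<close>
  define C where "C = {v \<in> carrier_vec N. \<forall>j<N. v \<bullet> col A j = v $ j}"
  show "LCD_code N C" "even_code C" "is_projector N C A"
  proof -
    have colN: "col A j \<in> carrier_vec N" for j using A by auto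
    have bin: "binary_code N C"
      unfolding binary_code_iff C_def
      by (auto simp: add_scalar_prod_distrib[OF _ _ colN] scalar_prod_left_zero[OF colN])
    have rowcol: "row A j = col A j" if "j < N" for j
      by (rule eq_vecI) (use A sym that in auto)
    \<comment> \<open>Idempotence says that each row of \<open>A\<close> is fixed by
      \<open>A\<close>; by symmetry the rows are the columns.\<close>
    have colC: "col A j \<in> C" if j: "j < N" for j
    proof -
      have "col A j \<bullet> col A i = col A j $ i" if i: "i < N" for i
        using arg_cong[OF idem, of "\<lambda>M. M $$ (j, i)"] A i j rowcol[OF j] sym[OF i j] by simp
      then show ?thesis using A by (auto simp: C_def)
    qed
    have dual: "v \<bullet> col A j = 0" if "v \<in> dual_code N C" "j < N" for v j
      using that colC by (auto simp: dual_code_def)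
    show "is_projector N C A"
      unfolding is_projector_iff[OF bin] using A dual by (auto simp: C_def)
    \<comment> \<open>Such a word is both fixed and annihilated by \<open>A\<close>.\<close>
    have "v = 0\<^sub>v N" if "v \<in> C" "v \<in> dual_code N C" for v
    proof (rule eq_vecI)
      fix j assume "j < dim_vec (0\<^sub>v N :: bit vec)"
      then show "v $ j = 0\<^sub>v N $ j" using that dual by (auto simp: C_def)
    qed (use that in \<open>auto simp: C_def\<close>)
    moreover have "0\<^sub>v N \<in> C \<inter> dual_code N C"
      using bin binary_code_dual[OF bin] by (simp add: binary_code_iff)
    ultimately show "LCD_code N C" using bin by (auto simp: LCD_code_def)
    show "even_code C"
      unfolding even_code_def
    proof
      fix v assume v: "v \<in> C"
      then have vN: "v \<in> carrier_vec N" by (simp add: C_def)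
      \<comment> \<open>One factor \<open>v $ j\<close> is replaced using that \<open>v\<close> is
        fixed. This gives the quadratic form of \<open>A\<close> at \<open>v\<close>, which vanishes
        since \<open>A\<close> is symmetric with zero diagonal.\<close>
      have "v \<bullet> v = (\<Sum>j<N. v $ j * (v \<bullet> col A j))"
        unfolding scalar_prod_def[of v v] atLeast0LessThan using v vN
        by (intro sum.cong) (auto simp: C_def)
      also have "\<dots> = (\<Sum>j<N. \<Sum>i<N. v $ j * (v $ i * A $$ (i, j)))"
        using A by (intro sum.cong)
          (auto simp: scalar_prod_def atLeast0LessThan sum_distrib_left simp del: mult_bit_eq_and)
      also have "\<dots> = 0"
      proof (rule sum_symmetric_bit_eq_0)
        fix i j assume "i < N" "j < N"
        then show "v $ i * (v $ j * A $$ (j, i)) = v $ j * (v $ i * A $$ (i, j))"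
          by (metis sym mult.left_commute)
      qed (simp add: diag)
      finally have "of_nat (hamming_weight v) = (0 :: bit)" by (simp add: of_nat_hamming_weight)
      then show "even (hamming_weight v)" by (simp add: of_nat_bit split: if_splits)
    qed
  qed
qed

section \<open>Adjacency matrices: idempotence and walks of length two\<close>

lemma yields_even_LCD_code_iff:
  assumes sym: "\<And>u v. (u, v) \<in> parcs G \<Longrightarrow> (v, u) \<in> parcs G"
    and irrefl: "\<And>v. (v, v) \<notin> parcs G"
  shows "yields_even_LCD_code G vs \<longleftrightarrow>
    adjacency_matrix G vs * adjacency_matrix G vs = adjacency_matrix G vs"
proof
  assume "yields_even_LCD_code G vs"
  then show "adjacency_matrix G vs * adjacency_matrix G vs = adjacency_matrix G vs"
    unfolding yields_even_LCD_code_def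
    using is_projector_idem orthogonal_projector_eq_iff by blast
next
  let ?A = "adjacency_matrix G vs"
  assume idem: "?A * ?A = ?A"
  have "?A \<in> carrier_mat (length vs) (length vs)" by (simp add: adjacency_matrix_def)
  moreover have "?A $$ (i, j) = ?A $$ (j, i)" if "i < length vs" "j < length vs" for i j
    using that sym by (auto simp: adjacency_matrix_def)
  moreover have "?A $$ (i, i) = 0" if "i < length vs" for i
    using that irrefl by (simp add: adjacency_matrix_def)
  ultimately obtain C where "LCD_code (length vs) C" "even_code C" "is_projector (length vs) C ?A"
    using symmetric_idem_is_projector[OF _ _ _ idem] by metis
  then show "yields_even_LCD_code G vs"
    unfolding yields_even_LCD_code_def using orthogonal_projector_eq_iff by blast
qed

lemma adjacency_matrix_square:
  assumes "distinct vs" "parcs G \<subseteq> set vs \<times> set vs" and ij: "i < length vs" "j < length vs"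
  shows "(adjacency_matrix G vs * adjacency_matrix G vs) $$ (i, j) =
    of_nat (card {u. (vs ! i, u) \<in> parcs G \<and> (u, vs ! j) \<in> parcs G})"
proof -
  let ?N = "length vs"
  let ?L = "{l\<in>{..<?N}. (vs ! i, vs ! l) \<in> parcs G \<and> (vs ! l, vs ! j) \<in> parcs G}"
  have "(adjacency_matrix G vs * adjacency_matrix G vs) $$ (i, j) =
      (\<Sum>l<?N. adjacency_matrix G vs $$ (i, l) * adjacency_matrix G vs $$ (l, j))"
    using ij by (simp add: adjacency_matrix_def scalar_prod_def atLeast0LessThan)
  also have "\<dots> =
      (\<Sum>l<?N. of_bool ((vs ! i, vs ! l) \<in> parcs G \<and> (vs ! l, vs ! j) \<in> parcs G))"
    using ij by (intro sum.cong) (auto simp: adjacency_matrix_def)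
  also have "\<dots> = of_nat (card ?L)"
    by (simp add: Int_def)
  \<comment> \<open>Passing from indices to vertices keeps the count because \<open>vs\<close> is
    distinct. The image contains all common neighbours because arcs only join members of
    \<open>vs\<close>.\<close>
  also have "card ?L = card ((!) vs ` ?L)"
    by (rule card_image[symmetric])
      (use assms in \<open>auto simp: inj_on_def nth_eq_iff_index_eq\<close>)
  also have "(!) vs ` ?L = {u. (vs ! i, u) \<in> parcs G \<and> (u, vs ! j) \<in> parcs G}"
    using assms(2) by (auto simp: image_iff in_set_conv_nth subset_iff)
  finally show ?thesis .
qed

section \<open>Common neighbours in the Johnson graph\<close>

text \<open>Each neighbour of \<open>S\<close> arises from exactly one exchange of some
  \<open>a\<close> in \<open>S\<close> for some \<open>b\<close> outside. The exchange lowers the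
  intersection with \<open>T\<close> by one if \<open>a \<in> T\<close> and raises it by one if
  \<open>b \<in> T\<close>. Adjacency to \<open>T\<close> thus becomes a condition on the pair,
  arranged without subtraction and uniform in the distance of \<open>S\<close> and
  \<open>T\<close>.\<close>

lemma card_common_neighbours:
  assumes X: "finite X" and S: "S \<subseteq> X" "card S = k" and T: "T \<subseteq> X" "card T = k"
  shows "card {U. (S, U) \<in> parcs (johnson_graph X k) \<and> (U, T) \<in> parcs (johnson_graph X k)} =
    card {(a, b). a \<in> S \<and> b \<in> X - S \<and>
      card (S \<inter> T) + of_bool (b \<in> T) + 1 = k + of_bool (a \<in> T)}" (is "card ?L = card ?R")
proof -
  let ?f = "\<lambda>(a, b). insert b (S - {a})"
  have fin: "finite S" "finite T" using X S T finite_subset by auto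
  have card_U: "card (insert b (S - {a})) = k" "card (S \<inter> insert b (S - {a})) + 1 = k"
    if "a \<in> S" "b \<in> X - S" for a b
  proof -
    have k: "card (S - {a}) + 1 = k" using that S fin card_Suc_Diff1[of S a] by simp
    then show "card (insert b (S - {a})) = k" using that fin by simp
    have "S \<inter> insert b (S - {a}) = S - {a}" using that by auto
    with k show "card (S \<inter> insert b (S - {a})) + 1 = k" by simp
  qed
  have card_T: "card (insert b (S - {a}) \<inter> T) + of_bool (a \<in> T) = card (S \<inter> T) + of_bool (b \<in> T)"
    if "a \<in> S" "b \<in> X - S" for a b
  proof -
    have "card ((S - {a}) \<inter> T) + of_bool (a \<in> T) = card (S \<inter> T)"
    proof (cases "a \<in> T")
      case True
      then have "(S - {a}) \<inter> T = S \<inter> T - {a}" by auto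
      with True that fin show ?thesis using card_Suc_Diff1[of "S \<inter> T" a] by simp
    next
      case False
      then have "(S - {a}) \<inter> T = S \<inter> T" by auto
      with False show ?thesis by simp
    qed
    moreover have "card (insert b (S - {a}) \<inter> T) = card ((S - {a}) \<inter> T) + of_bool (b \<in> T)"
      using that fin by (cases "b \<in> T") auto
    ultimately show ?thesis by simp
  qed
  have "inj_on ?f ?R"
  proof (rule inj_onI, clarify)
    fix a b a' b'
    assume "a \<in> S" "b \<in> X" "b \<notin> S" "a' \<in> S" "b' \<in> X" "b' \<notin> S"
      "insert b (S - {a}) = insert b' (S - {a'})"
    moreover from this have "b \<in> insert b' (S - {a'})" "a \<notin> insert b (S - {a})" by auto
    ultimately show "a = a' \<and> b = b'" by auto
  qed
  moreover have "?f ` ?R = ?L"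
  proof (intro equalityI subsetI)
    fix U assume "U \<in> ?f ` ?R"
    then obtain a b where ab: "a \<in> S" "b \<in> X - S" "U = insert b (S - {a})"
      "card (S \<inter> T) + of_bool (b \<in> T) + 1 = k + of_bool (a \<in> T)" by auto
    then show "U \<in> ?L"
      using card_U[OF ab(1,2)] card_T[OF ab(1,2)] S T by (auto simp: johnson_graph_def)
  next
    fix U assume U: "U \<in> ?L"
    then have U': "U \<subseteq> X" "card U = k" "card (S \<inter> U) + 1 = k" "card (U \<inter> T) + 1 = k"
      by (auto simp: johnson_graph_def)
    have finU: "finite U" using U' X finite_subset by auto
    \<comment> \<open>Two sets of size \<open>k\<close> sharing \<open>k - 1\<close> elements differ
      by one element on each side; these are the exchanged elements \<open>a\<close> and
      \<open>b\<close>.\<close>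
    have "card (S - U) = 1" "card (U - S) = 1"
      using U' S fin finU by (simp_all add: card_Diff_subset_Int Int_commute)
    then obtain a b where "S - U = {a}" "U - S = {b}" by (auto simp: card_1_singleton_iff)
    then have ab: "a \<in> S" "b \<in> X - S" and eq: "U = insert b (S - {a})" using U' by auto
    then have "(a, b) \<in> ?R" using card_T[OF ab] U' by auto
    then show "U \<in> ?f ` ?R" using eq by force
  qed
  ultimately show ?thesis using card_image by fastforce
qed

text \<open>For \<open>T = S\<close> every exchange has \<open>a \<in> T\<close> and
  \<open>b \<notin> T\<close>, so all pairs satisfy the condition.\<close>

lemma card_common_neighbours_self:
  assumes X: "finite X" "card X = n" and S: "S \<subseteq> X" "card S = k"
  shows "card {U. (S, U) \<in> parcs (johnson_graph X k) \<and> (U, S) \<in> parcs (johnson_graph X k)} =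
    k * (n - k)"
proof -
  have "{(a, b). a \<in> S \<and> b \<in> X - S \<and>
      card (S \<inter> S) + of_bool (b \<in> S) + 1 = k + of_bool (a \<in> S)} = S \<times> (X - S)"
    using S by auto
  moreover have "card (X - S) = n - k"
    using X S finite_subset by (metis card_Diff_subset)
  ultimately show ?thesis
    unfolding card_common_neighbours[OF X(1) S S] using S by (simp add: card_cartesian_product)
qed

text \<open>Here the condition says that \<open>a\<close> and \<open>b\<close> are both in
  \<open>T\<close> or both outside. The first case gives \<open>k - 1\<close> pairs and the second
  \<open>n - k - 1\<close>.\<close>

lemma card_common_neighbours_adj:
  assumes X: "finite X" "card X = n" and adj: "(S, T) \<in> parcs (johnson_graph X k)"
  shows "card {U. (S, U) \<in> parcs (johnson_graph X k) \<and> (U, T) \<in> parcs (johnson_graph X k)} = n - 2"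
proof -
  have S: "S \<subseteq> X" "card S = k" and T: "T \<subseteq> X" "card T = k" and m: "card (S \<inter> T) + 1 = k"
    using adj by (auto simp: johnson_graph_def)
  have fin: "finite S" "finite T" using X S T finite_subset by auto
  have one: "card (S - T) = 1" "card (T - S) = 1"
    using S T m fin by (simp_all add: card_Diff_subset_Int Int_commute)
  have "card (S \<union> T) = k + 1"
    using card_Un_Int[OF fin] S T m by simp
  \<comment> \<open>The bound \<open>le\<close> ensures that the truncated differences add up to
    \<open>n - 2\<close>.\<close>
  then have rest: "card (X - (S \<union> T)) = n - (k + 1)" and le: "k + 1 \<le> n"
    using X S T fin card_Diff_subset[of "S \<union> T" X] card_mono[of X "S \<union> T"] by auto
  have "{(a, b). a \<in> S \<and> b \<in> X - S \<and>
      card (S \<inter> T) + of_bool (b \<in> T) + 1 = k + of_bool (a \<in> T)} =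
      (S \<inter> T) \<times> (T - S) \<union> (S - T) \<times> (X - (S \<union> T))"
    using m T by auto
  moreover have "card ((S \<inter> T) \<times> (T - S) \<union> (S - T) \<times> (X - (S \<union> T))) =
      card ((S \<inter> T) \<times> (T - S)) + card ((S - T) \<times> (X - (S \<union> T)))"
    by (rule card_Un_disjoint) (use fin X in auto)
  ultimately show ?thesis
    unfolding card_common_neighbours[OF X(1) S T]
    using one rest m le by (simp add: card_cartesian_product)
qed

lemma even_card_common_neighbours:
  assumes X: "finite X" and S: "S \<subseteq> X" "card S = k" and T: "T \<subseteq> X" "card T = k"
    and "S \<noteq> T" and "(S, T) \<notin> parcs (johnson_graph X k)"
  shows "even (card {U. (S, U) \<in> parcs (johnson_graph X k) \<and> (U, T) \<in> parcs (johnson_graph X k)})"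
proof -
  have fin: "finite S" "finite T" using X S T finite_subset by auto
  \<comment> \<open>Distinct sets of size \<open>k\<close> share fewer than \<open>k\<close>
    elements, and non-adjacency excludes \<open>k - 1\<close>.\<close>
  have "card (S \<inter> T) < k"
    using assms fin by (metis card_subset_eq inf.cobounded1 inf.cobounded2 card_mono le_neq_implies_less)
  moreover have "card (S \<inter> T) + 1 \<noteq> k"
    using assms by (auto simp: johnson_graph_def)
  ultimately have m: "card (S \<inter> T) + 2 \<le> k" by simp
  let ?R = "{(a, b). a \<in> S \<and> b \<in> X - S \<and>
      card (S \<inter> T) + of_bool (b \<in> T) + 1 = k + of_bool (a \<in> T)}"
  have "even (card ?R)"
  \<comment> \<open>At distance 2 the exchange must remove an element outside \<open>T\<close> and
    insert one of \<open>T\<close>, with two choices each. At larger distance one exchange cannot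
    reach a neighbour of \<open>T\<close>.\<close>
  proof (cases "card (S \<inter> T) + 2 = k")
    case True
    have "?R = (S - T) \<times> (T - S)"
      using True T by (auto simp: of_bool_def split: if_splits)
    moreover have "card (S - T) = 2"
      using S True fin by (simp add: card_Diff_subset_Int)
    ultimately show ?thesis by (simp add: card_cartesian_product)
  next
    case False
    then have "?R = {}" using m by (auto simp: of_bool_def)
    then show ?thesis by (simp only: card.empty even_zero)
  qed
  then show ?thesis by (simp only: card_common_neighbours[OF X S T])
qed

text \<open>For \<open>k = 0\<close> or \<open>k = card X\<close> there is a single vertex, and the
  zero matrix is idempotent for either parity. Strictly between, one exchange gives an arc, at which
  idempotence can be tested.\<close>

lemma johnson_graph_has_arc:
  assumes "finite X" "0 < k" "k < card X"
  obtains S T where "(S, T) \<in> parcs (johnson_graph X k)"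
proof -
  obtain S where S: "S \<subseteq> X" "card S = k"
    using assms by (metis obtain_subset_with_card_n less_imp_le)
  have fin: "finite S" using S assms finite_subset by auto
  obtain a where a: "a \<in> S" using S assms by fastforce
  have "S \<noteq> X" using S assms by auto
  then obtain b where b: "b \<in> X" "b \<notin> S" using S by blast
  have "card (S - {a}) + 1 = k" using a S fin card_Suc_Diff1[of S a] by simp
  moreover have "S \<inter> insert b (S - {a}) = S - {a}" using b by auto
  moreover have "card (insert b (S - {a})) = card (S - {a}) + 1" using b fin by simp
  ultimately have "(S, insert b (S - {a})) \<in> parcs (johnson_graph X k)"
    using S b by (auto simp: johnson_graph_def)
  then show thesis by (rule that)
qed

section \<open>Idempotence of the adjacency matrix and the parity of \<open>n\<close>\<close>

theorem proposition4p7: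
  fixes X :: "'a set" and n k :: nat and vs :: "'a set list"
  assumes "finite X" and "card X = n"
    and "0 < k" and "k < n"
    and "distinct vs" and "set vs = pverts (johnson_graph X k)"
  shows "yields_even_LCD_code (johnson_graph X k) vs \<longleftrightarrow> odd n"
proof -
  let ?G = "johnson_graph X k"
  let ?A = "adjacency_matrix ?G vs"
  let ?c = "\<lambda>S T. card {U. (S, U) \<in> parcs ?G \<and> (U, T) \<in> parcs ?G}"
  have arcs: "parcs ?G \<subseteq> set vs \<times> set vs"
    using assms by (auto simp: johnson_graph_def)
  have sym: "(v, u) \<in> parcs ?G" if "(u, v) \<in> parcs ?G" for u v
    using that by (auto simp: johnson_graph_def Int_commute)
  have irrefl: "(v, v) \<notin> parcs ?G" for v
    by (auto simp: johnson_graph_def)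
  note sq = adjacency_matrix_square[OF \<open>distinct vs\<close> arcs]
  have "?A * ?A = ?A \<longleftrightarrow> odd n"
  proof
    assume idem: "?A * ?A = ?A"
    obtain S T where ST: "(S, T) \<in> parcs ?G"
      using johnson_graph_has_arc assms by metis
    then have "S \<in> set vs" "T \<in> set vs" using arcs by auto
    then obtain i j where ij: "i < length vs" "j < length vs" "S = vs ! i" "T = vs ! j"
      by (auto simp: in_set_conv_nth)
    have "?A $$ (i, j) = 1" using ij ST by (simp add: adjacency_matrix_def)
    then have "of_nat (n - 2) = (1 :: bit)"
      using sq[OF ij(1,2)] card_common_neighbours_adj[OF assms(1,2) ST] ij idem by simp
    \<comment> \<open>From \<open>0 < k\<close> and \<open>k < n\<close> follows
      \<open>2 \<le> n\<close>, so the truncated \<open>n - 2\<close> has the parity of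
      \<open>n\<close>.\<close>
    then show "odd n" using assms by (auto simp: of_nat_bit split: if_splits)
  next
    assume odd: "odd n"
    have entry: "of_nat (?c S T) = (if (S, T) \<in> parcs ?G then 1 else 0 :: bit)"
      if "S \<in> set vs" "T \<in> set vs" for S T
    proof -
      have S: "S \<subseteq> X" "card S = k" and T: "T \<subseteq> X" "card T = k"
        using that assms by (auto simp: johnson_graph_def)
      consider "S = T" | "(S, T) \<in> parcs ?G" | "S \<noteq> T" "(S, T) \<notin> parcs ?G" by blast
      then show ?thesis
      proof cases
        case 1
        \<comment> \<open>The factors add up to the odd number \<open>n\<close>, so one of them is
          even.\<close>
        have "even (k * (n - k))" using odd assms by auto
        with 1 show ?thesis
          using card_common_neighbours_self[OF assms(1,2) S] irrefl by (simp add: of_nat_bit)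
      next
        case 2
        have "odd (n - 2)" using odd assms by auto
        with 2 show ?thesis
          using card_common_neighbours_adj[OF assms(1,2) 2] by (simp add: of_nat_bit)
      next
        case 3
        then show ?thesis
          using even_card_common_neighbours[OF assms(1) S T] by (simp add: of_nat_bit)
      qed
    qed
    show "?A * ?A = ?A"
    proof (rule eq_matI)
      fix i j assume "i < dim_row ?A" "j < dim_col ?A"
      then have ij: "i < length vs" "j < length vs" by (auto simp: adjacency_matrix_def)
      then show "(?A * ?A) $$ (i, j) = ?A $$ (i, j)"
        unfolding sq[OF ij] using entry[of "vs ! i" "vs ! j"] by (simp add: adjacency_matrix_def)
    qed (simp_all add: adjacency_matrix_def)
  qed
  then show ?thesis using yields_even_LCD_code_iff[of ?G vs] sym irrefl by blast
qed

end
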